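(* Let $n=p_1^{a_1}\cdots p_r^{a_r}>1$ be the prime factorization of $n$. If all exponents $a_i$ ($i=1,\dots,r$) are even and $n$ is bi-unitary harmonic, then $\omega(n)\ge 2$.
   Context: $\omega(n)$ is the number of distinct prime factors of $n$. A divisor $d$ of $n$ is a unitary divisor if $\gcd(d,n/d)=1$; a divisor $d$ of $n$ is a bi-unitary divisor if the greatest common unitary divisor of $d$ and $n/d$ is $1$. $\sigma^{**}(n)$ denotes the sum and $d^{**}(n)$ the number of bi-unitary divisors of $n$. $n$ is bi-unitary harmonic if $\sigma^{**}(n)\mid n\,d^{**}(n)$. *)

theory Defs
  imports "HOL-Computational_Algebra.Primes"
begin

definition omega :: "nat \<Rightarrow> nat" where
  "omega n = card (prime_factors n)"

definition unitary_divisor :: "nat \<Rightarrow> nat \<Rightarrow> bool" where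
  "unitary_divisor d n \<longleftrightarrow> d dvd n \<and> gcd d (n div d) = 1"

text \<open>The greatest common unitary divisor. The set is never empty (it contains 1), and it is
  finite: even for \<open>a = b = 0\<close> it is just \<open>{1}\<close>.\<close>

definition gcud :: "nat \<Rightarrow> nat \<Rightarrow> nat" where
  "gcud a b = Max {u. unitary_divisor u a \<and> unitary_divisor u b}"

definition biunitary_divisor :: "nat \<Rightarrow> nat \<Rightarrow> bool" where
  "biunitary_divisor d n \<longleftrightarrow> d dvd n \<and> gcud d (n div d) = 1"

definition biunitary_sigma :: "nat \<Rightarrow> nat" where
  "biunitary_sigma n = (\<Sum>d | biunitary_divisor d n. d)"

definition biunitary_count :: "nat \<Rightarrow> nat" where
  "biunitary_count n = card {d. biunitary_divisor d n}"

text \<open>The notion concerns positive integers; 0 is excluded explicitly, since it has infinitely many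
  bi-unitary divisors, so that the sum and the cardinality above are both 0 by convention.\<close>

definition biunitary_harmonic :: "nat \<Rightarrow> bool" where
  "biunitary_harmonic n \<longleftrightarrow> n > 0 \<and> biunitary_sigma n dvd n * biunitary_count n"

end

(* If omega n = 1 then n = p^(2k), whose bi-unitary divisors are the powers p^j with j <= 2k, j \<noteq> k.
   Their sum is congruent to 1 modulo p, hence coprime to n, so it would have to divide their number 2k.
   But a sum of 2k positive integers, not all 1, exceeds 2k. *)
theory Submission
  imports Defs
begin

text \<open>A divisor \<open>p ^ i\<close> and its cofactor \<open>p ^ (a - i)\<close> share the
  factor \<open>p\<close> unless one of the two exponents vanishes.\<close>

lemma unitary_divisor_prime_power_iff:
  fixes p :: nat
  assumes "prime p"
  shows "unitary_divisor d (p ^ a) \<longleftrightarrow> d = 1 \<or> d = p ^ a"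
proof
  assume *: "unitary_divisor d (p ^ a)"
  then obtain i where i: "i \<le> a" "d = p ^ i"
    using divides_primepow_nat[OF assms] by (auto simp: unitary_divisor_def)
  have p: "p > 1"
    using assms by (rule prime_gt_1_nat)
  have "p ^ a div p ^ i = p ^ (a - i)"
    using i p by (simp add: power_diff)
  then have "coprime (p ^ i) (p ^ (a - i))"
    using * i by (simp add: unitary_divisor_def coprime_iff_gcd_eq_1)
  then have "i = 0 \<or> a - i = 0"
    using p by (auto simp: coprime_power_left_iff coprime_power_right_iff)
  then show "d = 1 \<or> d = p ^ a"
    using i by auto
next
  assume "d = 1 \<or> d = p ^ a"
  then show "unitary_divisor d (p ^ a)"
    using assms by (auto simp: unitary_divisor_def prime_gt_0_nat)
qed

text \<open>Besides 1, the two powers can share a unitary divisor only when they coincide; it is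
  then \<open>p ^ i\<close> itself, which equals 1 exactly for \<open>i = 0\<close>.\<close>

lemma gcud_prime_power_eq_1_iff:
  fixes p :: nat
  assumes "prime p"
  shows "gcud (p ^ i) (p ^ j) = 1 \<longleftrightarrow> i \<noteq> j \<or> i = 0"
proof -
  have p: "p > 1"
    using assms by (rule prime_gt_1_nat)
  have "{u. unitary_divisor u (p ^ i) \<and> unitary_divisor u (p ^ j)} =
      (if i = j then {1, p ^ i} else {1})"
    using p by (auto simp: unitary_divisor_prime_power_iff[OF assms] power_inject_exp)
  moreover have "max 1 (p ^ i) = p ^ i"
    using p by simp
  ultimately show ?thesis
    using p by (auto simp: gcud_def)
qed

text \<open>The cofactor of \<open>p ^ j\<close> is \<open>p ^ (2 * k - j)\<close>, and the
  exponents agree only in the middle, at \<open>j = k\<close>. Since \<open>k > 0\<close>, this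
  middle divisor is not 1 and really drops out.\<close>

lemma biunitary_divisors_even_prime_power:
  fixes p :: nat
  assumes "prime p" "k > 0"
  shows "{d. biunitary_divisor d (p ^ (2 * k))} = (\<lambda>j. p ^ j) ` ({..2 * k} - {k})"
proof -
  have p: "p > 1"
    using assms(1) by (rule prime_gt_1_nat)
  have *: "biunitary_divisor (p ^ j) (p ^ (2 * k)) \<longleftrightarrow> j \<noteq> k" if "j \<le> 2 * k" for j
  proof -
    have "p ^ (2 * k) div p ^ j = p ^ (2 * k - j)"
      using that p by (simp add: power_diff)
    then have "biunitary_divisor (p ^ j) (p ^ (2 * k)) \<longleftrightarrow> j \<noteq> 2 * k - j \<or> j = 0"
      using that gcud_prime_power_eq_1_iff[OF assms(1), of j "2 * k - j"]
      by (simp add: biunitary_divisor_def le_imp_power_dvd)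
    then show ?thesis
      using that assms(2) by auto
  qed
  have "\<exists>j\<le>2 * k. d = p ^ j" if "biunitary_divisor d (p ^ (2 * k))" for d
    using that divides_primepow_nat[OF assms(1)] by (auto simp: biunitary_divisor_def)
  with * show ?thesis
    by (fastforce simp: image_iff)
qed

lemma not_biunitary_harmonic_even_prime_power:
  fixes p :: nat
  assumes "prime p" "k > 0"
  shows "\<not> biunitary_harmonic (p ^ (2 * k))"
proof
  assume harm: "biunitary_harmonic (p ^ (2 * k))"
  define J where "J = {..2 * k} - {k}"
  define S where "S = (\<Sum>j\<in>J. p ^ j)"
  have p: "p > 1"
    using assms(1) by (rule prime_gt_1_nat)
  have J: "finite J" "card J = 2 * k" "0 \<in> J" "2 * k \<in> J"
    using assms(2) by (auto simp: J_def)
  \<comment> \<open>Distinct exponents give distinct divisors, so the sum and the number of divisors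
    can be computed over the exponent set \<open>J\<close>.\<close>
  have inj: "inj_on (\<lambda>j. p ^ j) J"
    using p by (auto intro!: inj_onI)
  have "biunitary_sigma (p ^ (2 * k)) = S" "biunitary_count (p ^ (2 * k)) = 2 * k"
    using sum.reindex[OF inj, of "\<lambda>d. d"] card_image[OF inj] J(2)
    by (simp_all add: biunitary_sigma_def biunitary_count_def S_def J_def
        biunitary_divisors_even_prime_power[OF assms])
  with harm have dvd: "S dvd p ^ (2 * k) * (2 * k)"
    by (simp add: biunitary_harmonic_def)
  \<comment> \<open>The exponent 0 contributes the 1; all remaining terms are multiples of
    \<open>p\<close>.\<close>
  have "S = 1 + (\<Sum>j\<in>J - {0}. p ^ j)"
    using J by (simp add: S_def sum.remove)
  moreover have "p dvd (\<Sum>j\<in>J - {0}. p ^ j)"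
    by (rule dvd_sum) auto
  ultimately have "\<not> p dvd S"
    using p by (metis dvd_add_left_iff nat_dvd_1_iff_1 less_irrefl)
  then have "coprime S (p ^ (2 * k))"
    using prime_imp_coprime[OF assms(1)] by (simp add: coprime_commute)
  with dvd have "S dvd 2 * k"
    by (simp add: coprime_dvd_mult_right_iff)
  then have "S \<le> 2 * k"
    using assms(2) by (simp add: dvd_imp_le)
  \<comment> \<open>The left side is \<open>card J = 2 * k\<close>. Strictness comes from the top
    exponent \<open>2 * k\<close>, which stays in \<open>J\<close> and is positive because
    \<open>k > 0\<close>.\<close>
  moreover have "(\<Sum>j\<in>J. 1) < S"
    unfolding S_def
  proof (rule sum_strict_mono_ex1)
    show "\<exists>j\<in>J. 1 < p ^ j"
      using J(4) one_less_power[OF p, of "2 * k"] assms(2) by auto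
  qed (use J p in auto)
  ultimately show False
    using J(2) by simp
qed

theorem theorem3:
  fixes n :: nat
  assumes "n > 1"
    and "\<forall>p\<in>prime_factors n. even (multiplicity p n)"
    and "biunitary_harmonic n"
  shows "omega n \<ge> 2"
proof (rule ccontr)
  assume "\<not> omega n \<ge> 2"
  moreover have "card (prime_factors n) \<noteq> 0"
    using assms(1) by (auto simp: prime_factorization_empty_iff)
  ultimately have "card (prime_factors n) = 1"
    unfolding omega_def by linarith
  then obtain p where p: "prime_factors n = {p}"
    by (rule card_1_singletonE)
  then have "prime p"
    by (metis in_prime_factors_imp_prime singletonI)
  have n: "n = p ^ multiplicity p n"
    using prime_factorization_nat[of n] assms(1) p by simp
  obtain k where k: "multiplicity p n = 2 * k"
    using assms(2) p by (auto elim: evenE)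
  \<comment> \<open>For \<open>k = 0\<close> the power would be 1, against
    \<open>n > 1\<close>.\<close>
  then have "n = p ^ (2 * k)" "k > 0"
    using n assms(1) by (auto intro: gr0I)
  then show False
    using not_biunitary_harmonic_even_prime_power[OF \<open>prime p\<close>] assms(3) by simp
qed

end
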